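(* Let $0<|q|<1$, let $\omega$ be a primitive cube root of unity, fix a fourth root $q^{1/4}$ of $q$ and let $q^{k/4}=(q^{1/4})^k$. Then $${}_2\phi_1\left(\begin{matrix}q^{1/4} \omega,-q^{3/4}\omega\\ -q\end{matrix};q,{q^{1/2}}{\omega^2}\right)=\frac{(q^3;q^6)_\infty}{(q^{1/2}\omega^2;q)_\infty(-q^{3/4},q^{5/4};-q^{3/2})_{\infty}(q^2;q^6)_\infty}.$$
   Context: Notation: $(a;p)_n=\prod_{m=0}^{n-1}(1-ap^m)$ for any base $p$ ($n=\infty$ allowed), $(a_1,\dots,a_m;p)_n=(a_1;p)_n\cdots(a_m;p)_n$, and ${}_{2}\phi_1\left(\begin{matrix}a,b\\c\end{matrix};q,z\right)=\sum_{n=0}^\infty\frac{(a,b;q)_n}{(q,c;q)_n}z^n.$ *)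

theory Defs
  imports "HOL-Analysis.Analysis"
begin

definition qpochs :: "complex list \<Rightarrow> complex \<Rightarrow> nat \<Rightarrow> complex" where
  "qpochs as p n = (\<Prod>a\<leftarrow>as. \<Prod>m<n. 1 - a * p ^ m)"

text \<open>
  The case \<open>n = \<infinity>\<close> of \<open>qpochs\<close>. The products converge for \<open>norm p < 1\<close>; a vanishing
  factor makes the value zero, by the convention of \<^const>\<open>has_prod\<close>.
\<close>

definition qpochs_inf :: "complex list \<Rightarrow> complex \<Rightarrow> complex" where
  "qpochs_inf as p = (\<Prod>a\<leftarrow>as. \<Prod>m. 1 - a * p ^ m)"

definition phi21 :: "complex \<Rightarrow> complex \<Rightarrow> complex \<Rightarrow> complex \<Rightarrow> complex \<Rightarrow> complex" where
  "phi21 a b c q z = (\<Sum>n. qpochs [a, b] q n / qpochs [q, c] q n * z ^ n)"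

definition primitive_root_of_unity :: "nat \<Rightarrow> complex \<Rightarrow> bool" where
  "primitive_root_of_unity n w \<longleftrightarrow> n > 0 \<and> w ^ n = 1 \<and> (\<forall>k. 0 < k \<and> k < n \<longrightarrow> w ^ k \<noteq> 1)"

end

theory Submission
  imports Defs
begin

text \<open>
  Put \<open>b = q\<^sup>1\<^sup>/\<^sup>4\<close> and \<open>Q = -b\<^sup>2\<close>, so that \<open>q = Q\<^sup>2\<close>. For \<open>x = X\<^sup>2\<close> and \<open>t = T\<^sup>2\<close>, the series
  \<open>\<phi>(t) = \<^sub>2\<phi>\<^sub>1(b x, -b\<^sup>3 x; -q; q, t / x)\<close> satisfies a second order \<open>q\<close>-difference equation in \<open>t\<close>. Let
  \<open>G(T) = (b T X, b T / X; Q)\<^sub>\<infinity> / (T X, T / X; Q)\<^sub>\<infinity>\<close> be the generating function of the Rogers polynomials. After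
  multiplication by infinite products, \<open>\<phi>(T\<^sup>2)\<close> and
  \<open>L(T) = \<Sum>k. (-b; Q)\<^sub>k / (Q; Q)\<^sub>k (-b)\<^sup>k G(T Q\<^sup>k)\<close> satisfy the same equation, which has only one
  solution with a given limit at \<open>0\<close>; this is a quadratic transformation. If \<open>X\<close> is a primitive cube
  root of unity and \<open>T = -b\<close>, then the factors \<open>1\<close>, \<open>X\<close>, \<open>1 / X\<close> combine to base \<open>Q\<^sup>3\<close> and the
  \<open>k\<close>-th term of \<open>L(-b)\<close> becomes a constant times
  \<open>(-b\<^sup>3; Q\<^sup>3)\<^sub>k / (Q\<^sup>3; Q\<^sup>3)\<^sub>k (-b)\<^sup>k\<close>, which the \<open>q\<close>-binomial theorem sums.
\<close>

section \<open>Infinite products and the q-binomial theorem\<close>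

definition qpoch :: "complex \<Rightarrow> complex \<Rightarrow> nat \<Rightarrow> complex" where
  "qpoch a p n = (\<Prod>m<n. 1 - a * p ^ m)"

definition qpoch_inf :: "complex \<Rightarrow> complex \<Rightarrow> complex" where
  "qpoch_inf a p = (\<Prod>m. 1 - a * p ^ m)"

lemma qpoch_0 [simp]: "qpoch a p 0 = 1"
  by (simp add: qpoch_def)

lemma qpoch_Suc: "qpoch a p (Suc n) = qpoch a p n * (1 - a * p ^ n)"
  by (simp add: qpoch_def)

lemma qpoch_add: "qpoch a p (n + m) = qpoch a p n * qpoch (a * p ^ n) p m"
  by (induction m) (simp_all add: qpoch_Suc power_add mult_ac)

lemma norm_mult_power_less_1:
  fixes a p :: complex
  assumes "norm p < 1" "norm a < 1"
  shows "norm (a * p ^ m) < 1"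
proof -
  have "norm (a * p ^ m) \<le> norm a"
    using assms by (auto simp: norm_mult norm_power intro!: mult_left_le power_le_one)
  then show ?thesis
    using assms(2) by simp
qed

lemma mult_power_neq_1:
  fixes a p :: complex
  assumes "norm p < 1" "norm a < 1"
  shows "1 - a * p ^ m \<noteq> 0"
  using norm_mult_power_less_1[OF assms, of m] by auto

lemma qpoch_nonzero:
  assumes "norm p < 1" "norm a < 1"
  shows "qpoch a p n \<noteq> 0"
  using mult_power_neq_1[OF assms] by (simp add: qpoch_def)

lemma convergent_prod_qpoch:
  fixes a p :: complex
  assumes "norm p < 1"
  shows "convergent_prod (\<lambda>m. 1 - a * p ^ m)"
proof (rule abs_convergent_prod_imp_convergent_prod)
  show "abs_convergent_prod (\<lambda>m. 1 - a * p ^ m)"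
    unfolding abs_convergent_prod_conv_summable
    using assms by (simp add: norm_mult norm_power summable_mult summable_geometric)
qed

lemma qpoch_LIMSEQ:
  assumes "norm p < 1"
  shows "(\<lambda>n. qpoch a p n) \<longlonglongrightarrow> qpoch_inf a p"
  using convergent_prod_LIMSEQ[OF convergent_prod_qpoch[OF assms, of a]]
  by (simp add: qpoch_def qpoch_inf_def LIMSEQ_lessThan_iff_atMost)

lemma qpoch_inf_nonzero:
  assumes "norm p < 1" "norm a < 1"
  shows "qpoch_inf a p \<noteq> 0"
  unfolding qpoch_inf_def
  by (intro prodinf_nonzero convergent_prod_qpoch mult_power_neq_1 assms)

lemma qpoch_inf_split:
  assumes "norm p < 1"
  shows "qpoch_inf a p = qpoch a p n * qpoch_inf (a * p ^ n) p"
proof -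
  have "(\<lambda>m. qpoch a p (n + m)) \<longlonglongrightarrow> qpoch a p n * qpoch_inf (a * p ^ n) p"
    unfolding qpoch_add by (intro tendsto_intros qpoch_LIMSEQ assms)
  moreover have "(\<lambda>m. qpoch a p (n + m)) \<longlonglongrightarrow> qpoch_inf a p"
    using LIMSEQ_ignore_initial_segment[OF qpoch_LIMSEQ[OF assms], of a n] by (simp add: add.commute)
  ultimately show ?thesis
    using LIMSEQ_unique by blast
qed

lemma qpoch_inf_Suc:
  assumes "norm p < 1"
  shows "qpoch_inf a p = (1 - a) * qpoch_inf (a * p) p"
  using qpoch_inf_split[OF assms, of a 1] by (simp add: qpoch_Suc)

text \<open>The tail is the full product divided by its first \<open>n\<close> factors; these
  converge to the full product, which is nonzero.\<close>

lemma qpoch_inf_shift_tendsto_1: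
  assumes "norm p < 1" "norm a < 1"
  shows "(\<lambda>n. qpoch_inf (a * p ^ n) p) \<longlonglongrightarrow> 1"
proof -
  have "(\<lambda>n. qpoch_inf a p / qpoch a p n) \<longlonglongrightarrow> qpoch_inf a p / qpoch_inf a p"
    by (intro tendsto_intros qpoch_LIMSEQ qpoch_inf_nonzero assms)
  moreover have "qpoch_inf a p / qpoch a p n = qpoch_inf (a * p ^ n) p" for n
    using qpoch_inf_split[OF assms(1), of a n] qpoch_nonzero[OF assms, of n] by simp
  ultimately show ?thesis
    using qpoch_inf_nonzero[OF assms] by simp
qed

section \<open>Dissection of infinite products\<close>

text \<open>Sort the factors by their exponent modulo \<open>k\<close>. For \<open>n * k\<close>
  factors this is an exchange of two finite products; the limit is taken along that
  subsequence.\<close>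

lemma qpoch_inf_dissect:
  assumes "norm p < 1" "k > 0"
  shows "qpoch_inf a p = (\<Prod>i<k. qpoch_inf (a * p ^ i) (p ^ k))"
proof -
  have "norm (p ^ k) < 1"
    using assms by (simp add: norm_power power_less_one_iff)
  then have "(\<lambda>n. \<Prod>i<k. qpoch (a * p ^ i) (p ^ k) n) \<longlonglongrightarrow> (\<Prod>i<k. qpoch_inf (a * p ^ i) (p ^ k))"
    by (intro tendsto_prod qpoch_LIMSEQ)
  moreover have "(\<Prod>i<k. qpoch (a * p ^ i) (p ^ k) n) = qpoch a p (n * k)" for n
  proof -
    have "qpoch a p (n * k) = (\<Prod>m<n. \<Prod>i = m * k..<m * k + k. 1 - a * p ^ i)"
      by (simp add: qpoch_def prod.nat_group)
    also have "\<dots> = (\<Prod>m<n. \<Prod>i<k. 1 - a * p ^ i * (p ^ k) ^ m)"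
    proof (rule prod.cong[OF refl])
      fix m
      have "(\<Prod>i = m * k..<m * k + k. 1 - a * p ^ i) = (\<Prod>i = 0..<k. 1 - a * p ^ (i + m * k))"
        using prod.shift_bounds_nat_ivl[of "\<lambda>i. 1 - a * p ^ i" 0 "m * k" k] by (simp add: add.commute)
      then show "(\<Prod>i = m * k..<m * k + k. 1 - a * p ^ i) = (\<Prod>i<k. 1 - a * p ^ i * (p ^ k) ^ m)"
        by (simp add: atLeast0LessThan power_add power_mult mult_ac flip: power_mult)
    qed
    also have "\<dots> = (\<Prod>i<k. qpoch (a * p ^ i) (p ^ k) n)"
      unfolding qpoch_def by (rule prod.swap)
    finally show ?thesis ..
  qed
  moreover have "(\<lambda>n. qpoch a p (n * k)) \<longlonglongrightarrow> qpoch_inf a p"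
    using LIMSEQ_subseq_LIMSEQ[OF qpoch_LIMSEQ[OF assms(1), of a], of "\<lambda>n. n * k"] assms(2)
    by (simp add: strict_mono_def o_def)
  ultimately show ?thesis
    using LIMSEQ_unique by auto
qed

lemma qpoch_inf_square:
  assumes "norm p < 1"
  shows "qpoch_inf a p * qpoch_inf (- a) p = qpoch_inf (a ^ 2) (p ^ 2)"
proof -
  have "(1 - a * p ^ m) * (1 - (- a) * p ^ m) = 1 - a ^ 2 * (p ^ 2) ^ m" for m
    by (simp add: power2_eq_square power_mult_distrib algebra_simps)
  then show ?thesis
    unfolding qpoch_inf_def by (subst prodinf_mult) (simp_all only: convergent_prod_qpoch assms)
qed

text \<open>Since \<open>w\<close> is a primitive cube root of unity, 1 / w = w^2, and the factors
  combine by (1 - y)(1 - w y)(1 - w^2 y) = 1 - y^3.\<close>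

lemma qpoch_inf_cube:
  assumes "norm p < 1" and w: "1 + w + w ^ 2 = 0"
  shows "qpoch_inf a p * (qpoch_inf (a * w) p * qpoch_inf (a / w) p) = qpoch_inf (a ^ 3) (p ^ 3)"
proof -
  have "w ^ 3 - 1 = (w - 1) * (1 + w + w ^ 2)"
    by (simp add: power2_eq_square power3_eq_cube algebra_simps)
  then have w3: "w ^ 3 = 1"
    using w by simp
  then have w0: "w \<noteq> 0"
    by auto
  have inv: "a / w = a * w ^ 2"
    using w3 w0 by (simp add: field_simps power3_eq_cube power2_eq_square)
  have "(1 - a * p ^ m) * ((1 - a * w * p ^ m) * (1 - a / w * p ^ m)) = 1 - a ^ 3 * (p ^ 3) ^ m" for m
  proof -
    have "(1 - y) * ((1 - w * y) * (1 - w ^ 2 * y))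
        = 1 - w ^ 3 * y ^ 3 - (1 + w + w ^ 2) * y * (1 - w * y)" for y :: complex
      by (simp add: power2_eq_square power3_eq_cube algebra_simps)
    then have "(1 - y) * ((1 - w * y) * (1 - w ^ 2 * y)) = 1 - y ^ 3" for y :: complex
      using w w3 by simp
    from this[of "a * p ^ m"] show ?thesis
      by (simp add: inv power_mult_distrib mult_ac flip: power_mult)
  qed
  then show ?thesis
    unfolding qpoch_inf_def
    by (simp only: prodinf_mult convergent_prod_qpoch convergent_prod_mult assms)
qed

section \<open>Power series and the q-binomial series\<close>

text \<open>Convergent coefficients are bounded, so a geometric series dominates. This covers
  quotients of q-shifted factorials.\<close>

lemma summable_convergent_coeffs:
  fixes c :: "nat \<Rightarrow> complex"
  assumes "convergent c" "norm z < 1"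
  shows "summable (\<lambda>n. norm (c n * z ^ n))"
proof -
  obtain K where K: "norm (c n) \<le> K" for n
    using BseqE[OF convergent_imp_Bseq[OF assms(1)]] by blast
  have "summable (\<lambda>n. K * norm z ^ n)"
    by (intro summable_mult summable_geometric) (simp add: assms(2))
  moreover have "norm (norm (c n * z ^ n)) \<le> K * norm z ^ n" if "n \<ge> 0" for n
    by (simp add: norm_mult norm_power mult_right_mono K)
  ultimately show ?thesis
    by (rule summable_comparison_test')
qed

text \<open>A power series is continuous at 0, and \<open>z * p ^ n\<close> tends to 0. Convergence
  at the nonzero point \<open>1/2\<close> gives the continuity.\<close>

lemma powser_shift_tendsto:
  fixes c :: "nat \<Rightarrow> complex"
  assumes c: "convergent c" and p: "norm p < 1"
  shows "(\<lambda>n. \<Sum>k. c k * (z * p ^ n) ^ k) \<longlonglongrightarrow> c 0"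
proof -
  have "isCont (\<lambda>x. \<Sum>k. c k * x ^ k) 0"
    using summable_norm_cancel[OF summable_convergent_coeffs[OF c, of "1/2"]]
    by (intro isCont_powser[where K = "1/2"]) auto
  moreover have "(\<lambda>n. z * p ^ n) \<longlonglongrightarrow> 0"
    using tendsto_mult_right_zero[OF LIMSEQ_power_zero[OF p]] .
  ultimately show ?thesis
    using isCont_tendsto_compose by fastforce
qed

lemma convergent_qpoch:
  "norm p < 1 \<Longrightarrow> convergent (qpoch a p)"
  using qpoch_LIMSEQ convergentI by blast

lemma convergent_qpoch_inverse:
  "norm p < 1 \<Longrightarrow> norm a < 1 \<Longrightarrow> convergent (\<lambda>n. inverse (qpoch a p n))"
  using tendsto_inverse[OF qpoch_LIMSEQ qpoch_inf_nonzero] convergentI by blast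

text \<open>The series \<open>f\<close> satisfies \<open>(1 - z) f(z) = (1 - a z) f(p z)\<close>; iterate this.\<close>

lemma q_binomial:
  assumes p: "norm p < 1" and z: "norm z < 1"
  shows "(\<lambda>n. qpoch a p n / qpoch p p n * z ^ n) sums (qpoch_inf (a * z) p / qpoch_inf z p)"
proof -
  define c where "c n = qpoch a p n / qpoch p p n" for n
  define f where "f z = (\<Sum>n. c n * z ^ n)" for z
  have c: "convergent c"
    unfolding c_def divide_inverse by (intro convergent_mult convergent_qpoch convergent_qpoch_inverse p)
  have sm: "summable (\<lambda>n. c n * y ^ n)" if "norm y < 1" for y
    using summable_convergent_coeffs[OF c that] by (rule summable_norm_cancel)
  have c0: "c 0 = 1"
    by (simp add: c_def)
  have rec: "c (Suc n) * (1 - p ^ Suc n) = c n * (1 - a * p ^ n)" for n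
    using mult_power_neq_1[OF p p, of n] qpoch_nonzero[OF p p, of n]
    by (simp add: c_def qpoch_Suc field_simps)
  have step: "(1 - y) * f y = (1 - a * y) * f (y * p)" if y: "norm y < 1" for y
  proof -
    have yp: "norm (y * p) < 1"
      using norm_mult_power_less_1[OF p y, of 1] by simp
    have "(\<lambda>n. c n * y ^ n - c n * (y * p) ^ n) sums (f y - f (y * p))"
      unfolding f_def by (intro sums_diff summable_sums sm y yp)
    \<comment> \<open>The two terms for \<open>n = 0\<close> cancel, so the sum may start at
      1.\<close>
    then have "(\<lambda>n. c (Suc n) * y ^ Suc n - c (Suc n) * (y * p) ^ Suc n) sums (f y - f (y * p))"
      by (subst sums_Suc_iff) simp
    moreover have "c (Suc n) * y ^ Suc n - c (Suc n) * (y * p) ^ Suc n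
        = y * (c n * y ^ n) - a * y * (c n * (y * p) ^ n)" for n
    proof -
      have "c (Suc n) * y ^ Suc n - c (Suc n) * (y * p) ^ Suc n = c (Suc n) * (1 - p ^ Suc n) * y ^ Suc n"
        by (simp add: power_mult_distrib algebra_simps)
      also have "\<dots> = y * (c n * y ^ n) - a * y * (c n * (y * p) ^ n)"
        unfolding rec by (simp add: power_mult_distrib algebra_simps)
      finally show ?thesis .
    qed
    moreover have "(\<lambda>n. y * (c n * y ^ n) - a * y * (c n * (y * p) ^ n)) sums (y * f y - a * y * f (y * p))"
      unfolding f_def by (intro sums_diff sums_mult summable_sums sm y yp)
    ultimately have "f y - f (y * p) = y * f y - a * y * f (y * p)"
      using sums_unique2 by simp
    then show ?thesis
      by (simp add: algebra_simps)
  qed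
  have iter: "qpoch z p n * f z = qpoch (a * z) p n * f (z * p ^ n)" for n
  proof (induction n)
    case (Suc n)
    have "qpoch z p (Suc n) * f z = (1 - z * p ^ n) * (qpoch z p n * f z)"
      by (simp add: qpoch_Suc)
    also have "\<dots> = qpoch (a * z) p n * ((1 - z * p ^ n) * f (z * p ^ n))"
      unfolding Suc by simp
    also have "(1 - z * p ^ n) * f (z * p ^ n) = (1 - a * z * p ^ n) * f (z * p ^ Suc n)"
      using step[OF norm_mult_power_less_1[OF p z, of n]] by (simp add: mult_ac)
    finally show ?case
      by (simp add: qpoch_Suc)
  qed simp
  have "(\<lambda>n. qpoch z p n * f z) \<longlonglongrightarrow> qpoch_inf z p * f z"
    by (intro tendsto_intros qpoch_LIMSEQ p)
  moreover have "(\<lambda>n. qpoch (a * z) p n * f (z * p ^ n)) \<longlonglongrightarrow> qpoch_inf (a * z) p * 1"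
    unfolding f_def using powser_shift_tendsto[OF c p, of z]
    by (intro tendsto_mult qpoch_LIMSEQ p) (simp add: c0)
  ultimately have "qpoch_inf z p * f z = qpoch_inf (a * z) p"
    unfolding iter using LIMSEQ_unique by fastforce
  then have "f z = qpoch_inf (a * z) p / qpoch_inf z p"
    using qpoch_inf_nonzero[OF p z] by (simp add: field_simps)
  then show ?thesis
    using summable_sums[OF sm[OF z]] by (simp add: f_def c_def)
qed

text \<open>The recurrence runs backwards from infinity. The larger of two consecutive norms grows
  at most by the factor \<open>1 + e n\<close> per step back, hence by at most
  \<open>exp (suminf e)\<close> in all, and it starts arbitrarily small.\<close>

lemma two_step_recurrence_unique:
  fixes a b d :: "nat \<Rightarrow> complex"
  assumes rec: "\<And>n. d n = a n * d (Suc n) + b n * d (Suc (Suc n))"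
    and bound: "\<And>n. norm (a n) + norm (b n) \<le> 1 + e n"
    and e: "summable e" "\<And>n. 0 \<le> e n"
    and d: "d \<longlonglongrightarrow> 0"
  shows "d 0 = 0"
proof -
  define m where "m n = max (norm (d n)) (norm (d (Suc n)))" for n
  have m0: "0 \<le> m n" for n
    by (simp add: m_def le_max_iff_disj)
  have step: "m n \<le> (1 + e n) * m (Suc n)" for n
  proof -
    have "norm (d n) \<le> norm (a n) * norm (d (Suc n)) + norm (b n) * norm (d (Suc (Suc n)))"
      by (subst rec) (metis norm_mult norm_triangle_ineq)
    also have "\<dots> \<le> norm (a n) * m (Suc n) + norm (b n) * m (Suc n)"
      by (intro add_mono mult_left_mono) (auto simp: m_def)
    also have "\<dots> \<le> (1 + e n) * m (Suc n)"
      using mult_right_mono[OF bound m0] by (simp add: distrib_right)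
    finally have "norm (d n) \<le> (1 + e n) * m (Suc n)" .
    moreover have "norm (d (Suc n)) \<le> 1 * m (Suc n)"
      by (simp add: m_def)
    moreover have "1 * m (Suc n) \<le> (1 + e n) * m (Suc n)"
      using e(2) m0 by (intro mult_right_mono) auto
    ultimately show ?thesis
      by (auto simp: m_def)
  qed
  have "m 0 \<le> exp (suminf e) * m n" for n
  proof -
    have "m 0 \<le> (\<Prod>i<n. 1 + e i) * m n"
    proof (induction n)
      case (Suc n)
      have "(\<Prod>i<n. 1 + e i) * m n \<le> (\<Prod>i<n. 1 + e i) * ((1 + e n) * m (Suc n))"
        using e(2) by (intro mult_left_mono step prod_nonneg) simp
      with Suc show ?case
        by (simp add: mult_ac)
    qed simp
    also have "(\<Prod>i<n. 1 + e i) \<le> exp (\<Sum>i<n. e i)"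
      using e(2) by (intro prod_le_exp_sum) auto
    also have "\<dots> \<le> exp (suminf e)"
      using e by (simp add: sum_le_suminf)
    finally show ?thesis
      using m0 by (simp add: mult_right_mono)
  qed
  moreover have "(\<lambda>n. exp (suminf e) * m n) \<longlonglongrightarrow> exp (suminf e) * max (norm (0::complex)) (norm (0::complex))"
    unfolding m_def by (intro tendsto_intros d LIMSEQ_Suc)
  ultimately have "m 0 \<le> 0"
    using LIMSEQ_le_const by fastforce
  then show ?thesis
    by (auto simp: m_def)
qed

section \<open>A quadratic transformation\<close>

text \<open>On the circle \<open>norm X = 1\<close>, the numbers \<open>t * X\<close> and
  \<open>t / X\<close> have the norm of \<open>t\<close>, so \<open>P2 t\<close> has no zero in the
  unit disc. The transformation holds for all such \<open>X\<close>; a cube root of unity enters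
  only in the closed form.\<close>

locale quadratic_transformation =
  fixes b X :: complex
  assumes b: "norm b < 1" and X: "norm X = 1"
begin

text \<open>
  \<open>T n = -b Q\<^sup>n\<close> is the sequence of arguments, and \<open>z n = T n\<^sup>2 / x\<close>. \<open>Y\<close> and \<open>Z\<close> are the values at \<open>T n\<close> of
  \<open>(T\<^sup>2 / x; q)\<^sub>\<infinity> \<phi>(T\<^sup>2)\<close> and of \<open>(T X, T / X; Q)\<^sub>\<infinity> L(T)\<close>, and \<open>g n = G(T n)\<close>.
\<close>

definition Q where "Q = - (b ^ 2)"

definition x where "x = X ^ 2"

definition P2 where "P2 t = qpoch_inf (t * X) Q * qpoch_inf (t / X) Q"

definition T where "T n = - b * Q ^ n"

definition c where
  "c n = qpoch (b * x) (b ^ 4) n * qpoch (- (b ^ 3) * x) (b ^ 4) n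
     / (qpoch (b ^ 4) (b ^ 4) n * qpoch (- (b ^ 4)) (b ^ 4) n)"

definition phi where "phi z = (\<Sum>n. c n * z ^ n)"

definition z where "z n = b ^ 2 / x * (b ^ 4) ^ n"

definition Y where "Y n = qpoch_inf (z n) (b ^ 4) * phi (z n)"

text \<open>These are the terms of the q-binomial series in base \<open>Q\<close> with parameter and
  argument both \<open>- b\<close>.\<close>

definition w where "w k = qpoch (- b) Q k / qpoch Q Q k * (- b) ^ k"

definition g where "g m = P2 (Q ^ Suc m) / P2 (T m)"

definition L where "L n = (\<Sum>k. w k * g (n + k))"

definition Z where "Z n = P2 (T n) * L n"

lemma norm_pow_b: "k > 0 \<Longrightarrow> norm (b ^ k) < 1"
  using b by (simp add: norm_power power_less_one_iff)

lemma norm_Q: "norm Q < 1"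
  using norm_pow_b[of 2] by (simp add: Q_def)

lemma X0: "X \<noteq> 0"
  using X by auto

lemma norm_x: "norm x = 1"
  using X by (simp add: x_def norm_power)

lemma x0: "x \<noteq> 0"
  using norm_x by auto

lemma b4: "b ^ 4 = Q ^ 2"
  by (simp add: Q_def flip: power_mult)

lemma norm_z: "norm (z n) < 1"
  unfolding z_def using norm_pow_b
  by (intro norm_mult_power_less_1) (simp_all add: norm_divide norm_x)

lemma z_Suc: "z (Suc n) = z n * b ^ 4"
  by (simp add: z_def)

section \<open>The q-difference equation of the hypergeometric series\<close>

lemma convergent_c: "convergent c"
proof -
  have "convergent (\<lambda>n. qpoch (b * x) (b ^ 4) n * qpoch (- (b ^ 3) * x) (b ^ 4) n
      * (inverse (qpoch (b ^ 4) (b ^ 4) n) * inverse (qpoch (- (b ^ 4)) (b ^ 4) n)))"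
    using norm_pow_b[of 4]
    by (intro convergent_mult convergent_qpoch convergent_qpoch_inverse) simp_all
  then show ?thesis
    by (simp add: c_def [abs_def] divide_inverse)
qed

text \<open>The denominators for \<open>q\<close> and \<open>-q\<close> combine to 1 - q^(2n+2) with
  \<open>q = b ^ 4\<close>, and 1 - b^2 = 1 + Q in the expanded numerator.\<close>

lemma c_Suc: "c (Suc n) * (1 - (b ^ 4) ^ (2 * Suc n))
    = c n * (1 - b * (1 + Q) * x * (b ^ 4) ^ n - x ^ 2 * b ^ 4 * (b ^ 4) ^ (2 * n))"
proof -
  define q where "q = b ^ 4"
  have q: "norm q < 1"
    using norm_pow_b by (simp add: q_def)
  have nz: "1 - q ^ Suc n \<noteq> 0" "1 + q ^ Suc n \<noteq> 0"
    using mult_power_neq_1[of q q n] mult_power_neq_1[of q "- q" n] q by auto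
  have "c (Suc n) * ((1 - q ^ Suc n) * (1 + q ^ Suc n))
      = c n * ((1 - b * x * q ^ n) * (1 + b ^ 3 * x * q ^ n))"
  proof -
    have "A * u * (B * v) / (D * s * (E * t)) * (s * t) = A * B / (D * E) * (u * v)"
      if "s \<noteq> 0" "t \<noteq> 0" for A B D E s t u v :: complex
      using that by simp
    from this[OF nz(1,2)] show ?thesis
      unfolding c_def q_def[symmetric] by (simp add: qpoch_Suc)
  qed
  moreover have "(1 - q ^ Suc n) * (1 + q ^ Suc n) = 1 - q ^ (2 * Suc n)"
    by (simp add: algebra_simps power2_eq_square power_mult power_mult_distrib)
  moreover have "(1 - b * x * q ^ n) * (1 + b ^ 3 * x * q ^ n)
      = 1 - b * (1 + Q) * x * q ^ n - x ^ 2 * q * q ^ (2 * n)"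
  proof -
    have "(1 - b * x * s) * (1 + b ^ 3 * x * s) = 1 - b * (1 + Q) * x * s - x ^ 2 * b ^ 4 * s ^ 2" for s
      by (simp add: Q_def algebra_simps power2_eq_square power3_eq_cube power4_eq_xxxx)
    from this[of "q ^ n"] show ?thesis
      by (simp add: q_def power_even_eq)
  qed
  ultimately show ?thesis
    by (simp only: q_def)
qed

text \<open>Multiply \<open>c_Suc\<close> by \<open>y ^ Suc n\<close> and sum: each power q^(jn),
  where \<open>q = b ^ 4\<close>, turns into the argument y q^j.\<close>

lemma phi_recurrence:
  assumes y: "norm y < 1"
  shows "(1 - y) * phi y + b * (1 + Q) * x * y * phi (y * b ^ 4)
    - (1 - b ^ 4 * y * x ^ 2) * phi (y * (b ^ 4) ^ 2) = 0"
proof -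
  define q where "q = b ^ 4"
  have q: "norm q < 1"
    using norm_pow_b by (simp add: q_def)
  have phi: "(\<lambda>n. c n * (y * q ^ j) ^ n) sums phi (y * q ^ j)" for j
    unfolding phi_def
    by (intro summable_sums summable_norm_cancel[OF summable_convergent_coeffs] convergent_c
        norm_mult_power_less_1 q y)
  have p0: "(\<lambda>n. c n * y ^ n) sums phi y"
    using phi[of 0] by simp
  have "(\<lambda>n. c (Suc n) * y ^ Suc n - c (Suc n) * (y * q ^ 2) ^ Suc n) sums (phi y - phi (y * q ^ 2))"
    using sums_diff[OF p0 phi[of 2]] by (subst sums_Suc_iff) simp
  moreover have "c (Suc n) * y ^ Suc n - c (Suc n) * (y * q ^ 2) ^ Suc n
      = y * (c n * y ^ n) - b * (1 + Q) * x * y * (c n * (y * q ^ 1) ^ n)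
        - x ^ 2 * q * y * (c n * (y * q ^ 2) ^ n)" for n
  proof -
    have "c (Suc n) * y ^ Suc n - c (Suc n) * (y * q ^ 2) ^ Suc n
        = c (Suc n) * (1 - q ^ (2 * Suc n)) * y ^ Suc n"
      by (simp only: power_mult_distrib power_mult) (simp add: algebra_simps)
    also have "\<dots> = c n * (1 - b * (1 + Q) * x * q ^ n - x ^ 2 * q * q ^ (2 * n)) * y ^ Suc n"
      unfolding q_def c_Suc ..
    finally show ?thesis
      by (simp add: power_mult_distrib algebra_simps flip: power_mult)
  qed
  moreover have "(\<lambda>n. y * (c n * y ^ n) - b * (1 + Q) * x * y * (c n * (y * q ^ 1) ^ n)
        - x ^ 2 * q * y * (c n * (y * q ^ 2) ^ n)) sums
      (y * phi y - b * (1 + Q) * x * y * phi (y * q ^ 1) - x ^ 2 * q * y * phi (y * q ^ 2))"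
    by (intro sums_diff sums_mult phi p0)
  ultimately have "phi y - phi (y * q ^ 2)
      = y * phi y - b * (1 + Q) * x * y * phi (y * q ^ 1) - x ^ 2 * q * y * phi (y * q ^ 2)"
    using sums_unique2 by simp
  then show ?thesis
    by (simp add: q_def algebra_simps)
qed

text \<open>The product in \<open>Y\<close> absorbs the leading coefficient \<open>1 - z n\<close>
  of \<open>phi_recurrence\<close>; in exchange the last coefficient gains the factor 1 - q z n. The
  rest is the substitution T n^2 = x z n.\<close>

lemma Y_recurrence:
  "Y n = - (b * (1 + Q) * T n ^ 2) * Y (Suc n)
    + (1 - Q ^ 2 * T n ^ 2 * x) * (1 - Q ^ 2 * T n ^ 2 / x) * Y (Suc (Suc n))"
proof -
  define q where "q = b ^ 4"
  have q: "norm q < 1"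
    using norm_pow_b by (simp add: q_def)
  have T2: "T n ^ 2 = x * z n"
    using x0 by (simp add: T_def z_def b4 power_mult_distrib power2_commute flip: power_mult)
       (simp add: mult.commute)
  have qQ: "Q ^ 2 = q"
    by (simp add: q_def b4)
  have z1: "z (Suc n) = z n * q" "z (Suc (Suc n)) = z n * q * q"
    by (simp_all add: z_Suc q_def)
  have "qpoch_inf (z n * q) q * ((1 - z n) * phi (z n) + b * (1 + Q) * x * z n * phi (z n * q)
      - (1 - q * z n * x ^ 2) * phi (z n * q ^ 2)) = 0"
    using phi_recurrence[OF norm_z, of n] by (simp add: q_def)
  then have *: "qpoch_inf (z n * q) q * ((1 - z n) * phi (z n))
      = (1 - q * z n * x ^ 2) * (qpoch_inf (z n * q) q * phi (z n * q ^ 2))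
        - b * (1 + Q) * x * z n * (qpoch_inf (z n * q) q * phi (z n * q))"
    by (simp add: algebra_simps)
  have "Y n = qpoch_inf (z n * q) q * ((1 - z n) * phi (z n))"
    unfolding Y_def q_def[symmetric] by (subst qpoch_inf_Suc[OF q]) simp
  also note *
  also have "qpoch_inf (z n * q) q * phi (z n * q) = Y (Suc n)"
    by (simp add: Y_def z1 flip: q_def)
  also have "qpoch_inf (z n * q) q * phi (z n * q ^ 2) = (1 - z n * q) * Y (Suc (Suc n))"
    unfolding Y_def z1 q_def[symmetric]
    by (subst qpoch_inf_Suc[OF q]) (simp add: power2_eq_square mult.assoc)
  finally show ?thesis
    unfolding T2 qQ using x0 by (simp add: power2_eq_square mult_ac)
qed

lemma Y_tendsto: "Y \<longlonglongrightarrow> 1"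
proof -
  have c0: "c 0 = 1"
    by (simp add: c_def)
  have q: "norm (b ^ 4) < 1"
    using norm_pow_b by simp
  have "(\<lambda>n. phi (z n)) \<longlonglongrightarrow> 1"
    unfolding phi_def z_def using powser_shift_tendsto[OF convergent_c q, of "b ^ 2 / x"] by (simp only: c0)
  moreover have "(\<lambda>n. qpoch_inf (z n) (b ^ 4)) \<longlonglongrightarrow> 1"
    unfolding z_def using norm_z[of 0] by (intro qpoch_inf_shift_tendsto_1 q) (simp add: z_def)
  ultimately show ?thesis
    unfolding Y_def [abs_def] using tendsto_mult by fastforce
qed

section \<open>The equation for the sum over Rogers generating functions\<close>

lemma P2_step: "P2 t = (1 - (X + 1 / X) * t + t ^ 2) * P2 (t * Q)"
proof -
  have "P2 t = ((1 - t * X) * (1 - t / X)) * (qpoch_inf (t * X * Q) Q * qpoch_inf (t / X * Q) Q)"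
    unfolding P2_def by (subst (1 2) qpoch_inf_Suc[OF norm_Q]) simp
  also have "(1 - t * X) * (1 - t / X) = 1 - (X + 1 / X) * t + t ^ 2"
    using X0 by (simp add: field_simps power2_eq_square)
  finally show ?thesis
    by (simp add: P2_def mult_ac)
qed

lemma P2_nonzero: "norm t < 1 \<Longrightarrow> P2 t \<noteq> 0"
  by (simp add: P2_def qpoch_inf_nonzero norm_Q norm_mult norm_divide X)

lemma P2_tendsto: "norm t < 1 \<Longrightarrow> (\<lambda>n. P2 (t * Q ^ n)) \<longlonglongrightarrow> 1"
  using tendsto_mult[OF qpoch_inf_shift_tendsto_1[OF norm_Q, of "t * X"]
      qpoch_inf_shift_tendsto_1[OF norm_Q, of "t / X"]]
  by (simp add: P2_def norm_mult norm_divide X mult_ac)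

lemma norm_T: "norm (T n) < 1"
  unfolding T_def using b by (intro norm_mult_power_less_1 norm_Q) simp

lemma T_add: "T (n + k) = T n * Q ^ k"
  by (simp add: T_def power_add)

text \<open>Since \<open>Q = - (b ^ 2)\<close>, the product \<open>b * T m\<close> is
  \<open>Q ^ Suc m\<close>.\<close>

lemma g_alt: "g m = P2 (b * T m) / P2 (T m)"
  by (simp add: g_def T_def Q_def power2_eq_square mult.assoc)

lemma g_step:
  "(1 - (X + 1 / X) * T m + T m ^ 2) * g m = (1 - (X + 1 / X) * (b * T m) + (b * T m) ^ 2) * g (Suc m)"
proof -
  have T1: "T (Suc m) = T m * Q"
    by (simp add: T_def)
  \<comment> \<open>By \<open>P2_step\<close>, a zero of this factor would be a zero of
    \<open>P2 (T m)\<close>.\<close>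
  have "1 - (X + 1 / X) * T m + T m ^ 2 \<noteq> 0"
    using P2_nonzero[OF norm_T, of m] P2_step[of "T m"] by auto
  then show ?thesis
    unfolding g_alt T1 by (subst P2_step[of "T m"], subst P2_step[of "b * T m"]) (simp add: mult_ac)
qed

lemma g_tendsto: "g \<longlonglongrightarrow> 1"
proof -
  have "(\<lambda>m. P2 (Q * Q ^ m) / P2 (- b * Q ^ m)) \<longlonglongrightarrow> 1 / 1"
    using b by (intro tendsto_divide P2_tendsto norm_Q) simp_all
  then show ?thesis
    by (simp add: g_def [abs_def] T_def)
qed

text \<open>The ratio (1 + b Q^k)(-b) equals \<open>Q ^ Suc k - b\<close> because -b^2 = Q; in this
  form it feeds \<open>telescoping_coefficients\<close>.\<close>

lemma w_Suc: "(1 - Q ^ Suc k) * w (Suc k) = (Q ^ Suc k - b) * w k"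
proof -
  have "1 - Q ^ Suc k \<noteq> 0"
    using mult_power_neq_1[OF norm_Q norm_Q, of k] by simp
  moreover have "s * (A * u / (D * s) * (y * v)) = u * v * (A / D * y)"
    if "s \<noteq> 0" for s A u D y v :: complex
    using that by simp
  ultimately have "(1 - Q ^ Suc k) * w (Suc k) = (1 + b * Q ^ k) * (- b) * w k"
    by (simp add: w_def qpoch_Suc)
  also have "(1 + b * Q ^ k) * (- b) = Q ^ Suc k - b"
    by (simp add: Q_def power2_eq_square algebra_simps)
  finally show ?thesis .
qed

lemma summable_w: "summable (\<lambda>k. norm (w k))"
  unfolding w_def using b
  by (intro summable_convergent_coeffs)
     (auto simp: divide_inverse intro!: convergent_mult convergent_qpoch convergent_qpoch_inverse norm_Q)

lemma summable_w_g: "summable (\<lambda>k. w k * g (n + k))"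
proof -
  obtain K where "norm (g m) \<le> K" for m
    using BseqE[OF convergent_imp_Bseq[OF convergentI[OF g_tendsto]]] by blast
  then have "norm (w k * g (n + k)) \<le> norm (w k) * K" for k
    by (simp add: norm_mult mult_left_mono)
  then show ?thesis
    by (intro summable_comparison_test'[where N = 0, OF summable_mult2[OF summable_w, of K]])
qed

text \<open>
  The certificate for the telescoping in \<open>L_recurrence\<close>, with \<open>s = Q\<^sup>k\<close> and
  \<open>p\<close>, \<open>w0\<close>, \<open>w1\<close> the values of \<open>w\<close> at \<open>k - 1\<close>, \<open>k\<close>, \<open>k + 1\<close> (\<open>p = 0\<close> for \<open>k = 0\<close>).
\<close>

lemma telescoping_coefficients:
  fixes w0 w1 p s t y :: complex
  assumes "(1 - s) * w0 = (s - b) * p" and "(1 - Q * s) * w1 = (Q * s - b) * w0"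
  shows "(1 - y * t + t ^ 2) * w1 + b * (1 + Q) * t ^ 2 * w0 - (1 + y * Q * t + Q ^ 2 * t ^ 2) * p
    = (w1 + w0) * (1 - y * (t * (Q * s)) + (t * (Q * s)) ^ 2)
      - (w0 + p) * (1 - y * (b * (t * s)) + (b * (t * s)) ^ 2)" (is "?l = ?r")
proof -
  define e0 e1 where "e0 = (1 - s) * w0 - (s - b) * p" and "e1 = (1 - Q * s) * w1 - (Q * s - b) * w0"
  \<comment> \<open>\<open>e0\<close> and \<open>e1\<close> are the defects of the two hypotheses;
    the difference of the sides is a linear combination of them.\<close>
  have "?l - ?r = y * t * (b * e0 - e1) + t ^ 2 * ((1 + Q * s) * e1 + Q * (s + b) * e0)"
    unfolding e0_def e1_def Q_def by (simp add: algebra_simps power2_eq_square)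
  then show ?thesis
    using assms by (simp add: e0_def e1_def)
qed

text \<open>Apply the operator termwise and collect the coefficient of each
  \<open>g (n + j)\<close>. With \<open>g_step\<close> these contributions telescope, and the
  boundary terms vanish because \<open>w\<close> tends to 0.\<close>

lemma L_recurrence:
  "(1 - (X + 1 / X) * T n + T n ^ 2) * L n + b * (1 + Q) * T n ^ 2 * L (Suc n)
    - (1 + (X + 1 / X) * Q * T n + Q ^ 2 * T n ^ 2) * L (Suc (Suc n)) = 0"
proof -
  define y where "y = X + 1 / X"
  define t where "t = T n"
  define u where "u = 1 - y * t + t ^ 2"
  define v where "v = b * (1 + Q) * t ^ 2"
  define v' where "v' = 1 + y * Q * t + Q ^ 2 * t ^ 2"
  \<comment> \<open>The shift of \<open>w\<close>, with value 0 at \<open>k = 0\<close>. Its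
    recurrence holds there too, since 1 - Q^0 = 0.\<close>
  define wp where "wp k = (case k of 0 \<Rightarrow> 0 | Suc j \<Rightarrow> w j)" for k
  define h where "h k = 1 - y * (t * Q ^ k) + (t * Q ^ k) ^ 2" for k
  define f where "f k = u * (w k * g (n + k)) + v * (w k * g (Suc n + k)) - v' * (w k * g (Suc (Suc n) + k))" for k
  have wp: "(1 - Q ^ k) * w k = (Q ^ k - b) * wp k" for k
    using w_Suc by (cases k) (simp_all add: wp_def)
  have g: "h k * g (n + k) = (1 - y * (b * (t * Q ^ k)) + (b * (t * Q ^ k)) ^ 2) * g (Suc (n + k))" for k
    using g_step[of "n + k"] by (simp add: h_def y_def t_def T_add)
  \<comment> \<open>Three boundary terms remain, because the last summand reaches up to
    \<open>g (Suc (Suc (n + N)))\<close>.\<close>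
  have partial: "(\<Sum>k<Suc N. f k) = (w N + wp N) * (h N * g (n + N))
      + (v * w N - v' * wp N) * g (Suc (n + N)) - v' * w N * g (Suc (Suc (n + N)))" for N
  proof (induction N)
    case 0
    then show ?case
      by (simp add: f_def h_def u_def wp_def algebra_simps)
  next
    case (Suc N)
    have e: "u * w (Suc N) + v * w N - v' * wp N = (w (Suc N) + w N) * h (Suc N)
        - (w N + wp N) * (1 - y * (b * (t * Q ^ N)) + (b * (t * Q ^ N)) ^ 2)"
      unfolding u_def v_def v'_def h_def using telescoping_coefficients[OF wp[of N], of "w (Suc N)" y t] w_Suc[of N]
      by simp
    have "(u * w (Suc N) + v * w N - v' * wp N) * g (Suc (n + N))
        = (w (Suc N) + w N) * h (Suc N) * g (Suc (n + N)) - (w N + wp N) * (h N * g (n + N))"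
      unfolding e g by (simp only: left_diff_distrib mult.assoc)
    moreover have "wp (Suc N) = w N"
      by (simp add: wp_def)
    ultimately show ?case
      unfolding sum.lessThan_Suc[of f "Suc N"] Suc.IH by (simp add: f_def algebra_simps)
  qed
  have w0: "w \<longlonglongrightarrow> 0"
    using summable_LIMSEQ_zero[OF summable_norm_cancel[OF summable_w]] .
  then have wp0: "wp \<longlonglongrightarrow> 0"
    by (subst filterlim_sequentially_Suc [symmetric]) (simp add: wp_def)
  have g1: "(\<lambda>N. g (n + N)) \<longlonglongrightarrow> 1" for n
    using LIMSEQ_ignore_initial_segment[OF g_tendsto, of n] by (simp add: add.commute)
  have h1: "h \<longlonglongrightarrow> 1 - y * (t * 0) + (t * 0) ^ 2"
    unfolding h_def by (intro tendsto_intros LIMSEQ_power_zero norm_Q)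
  have "(\<lambda>N. (w N + wp N) * (h N * g (n + N)) + (v * w N - v' * wp N) * g (Suc n + N)
      - v' * w N * g (Suc (Suc n) + N)) \<longlonglongrightarrow> (0 + 0) * ((1 - y * (t * 0) + (t * 0) ^ 2) * 1)
      + (v * 0 - v' * 0) * 1 - v' * 0 * 1"
    by (intro tendsto_intros w0 wp0 g1 h1)
  then have "(\<lambda>N. \<Sum>k<Suc N. f k) \<longlonglongrightarrow> 0"
    unfolding partial by simp
  moreover have "f sums (u * L n + v * L (Suc n) - v' * L (Suc (Suc n)))"
    unfolding f_def L_def by (intro sums_add sums_diff sums_mult summable_sums summable_w_g)
  ultimately have "u * L n + v * L (Suc n) - v' * L (Suc (Suc n)) = 0"
    using LIMSEQ_unique LIMSEQ_Suc unfolding sums_def by blast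
  then show ?thesis
    by (simp only: u_def v_def v'_def y_def t_def)
qed

text \<open>\<open>P2_step\<close> lets the factor \<open>P2 (T n)\<close> absorb the leading
  coefficient of \<open>L_recurrence\<close>, which yields the coefficients of
  \<open>Y_recurrence\<close>.\<close>

lemma Z_recurrence:
  "Z n = - (b * (1 + Q) * T n ^ 2) * Z (Suc n)
    + (1 - Q ^ 2 * T n ^ 2 * x) * (1 - Q ^ 2 * T n ^ 2 / x) * Z (Suc (Suc n))"
proof -
  define y where "y = X + 1 / X"
  define t where "t = T n"
  have T1: "T (Suc n) = t * Q" "T (Suc (Suc n)) = t * Q * Q"
    by (simp_all add: T_def t_def)
  have "P2 (t * Q) * ((1 - y * t + t ^ 2) * L n) = (1 + y * Q * t + Q ^ 2 * t ^ 2) * (P2 (t * Q) * L (Suc (Suc n)))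
      - b * (1 + Q) * t ^ 2 * (P2 (t * Q) * L (Suc n))"
    using arg_cong[OF L_recurrence[of n], of "\<lambda>s. P2 (t * Q) * s"]
    by (simp add: y_def t_def algebra_simps)
  moreover have "Z n = P2 (t * Q) * ((1 - y * t + t ^ 2) * L n)"
    unfolding Z_def t_def[symmetric] by (subst P2_step) (simp add: y_def)
  moreover have "Z (Suc n) = P2 (t * Q) * L (Suc n)"
    by (simp add: Z_def T1)
  moreover have "P2 (t * Q) * L (Suc (Suc n)) = (1 - y * (t * Q) + (t * Q) ^ 2) * Z (Suc (Suc n))"
    unfolding Z_def T1 by (subst P2_step) (simp add: y_def)
  ultimately have "Z n = (1 + y * Q * t + Q ^ 2 * t ^ 2) * ((1 - y * (t * Q) + (t * Q) ^ 2) * Z (Suc (Suc n)))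
      - b * (1 + Q) * t ^ 2 * Z (Suc n)"
    by simp
  \<comment> \<open>With s = Q t the left side is (1 + s^2)^2 - y^2 s^2, and y^2 - 2 = x + 1 /
    x.\<close>
  moreover have "(1 + y * Q * t + Q ^ 2 * t ^ 2) * (1 - y * (t * Q) + (t * Q) ^ 2)
      = (1 - Q ^ 2 * t ^ 2 * x) * (1 - Q ^ 2 * t ^ 2 / x)"
    using X0 by (simp add: y_def x_def field_simps power2_eq_square)
  ultimately show ?thesis
    by (simp add: t_def mult.assoc [symmetric])
qed

section \<open>Comparison of the two solutions\<close>

lemma sum_w: "suminf w = qpoch_inf (b ^ 2) Q / qpoch_inf (- b) Q"
  using sums_unique[OF q_binomial[OF norm_Q, of "- b" "- b"]] b
  by (simp add: w_def [abs_def] power2_eq_square)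

text \<open>\<open>g\<close> is bounded and tends to 1, so Tannery's theorem with the majorant
  \<open>norm (w k) * K\<close> takes the limit inside the sum.\<close>

lemma Z_tendsto: "Z \<longlonglongrightarrow> suminf w"
proof -
  obtain K where K: "norm (g m) \<le> K" for m
    using BseqE[OF convergent_imp_Bseq[OF convergentI[OF g_tendsto]]] by blast
  have "(\<lambda>n. \<Sum>k. w k * g (n + k)) \<longlonglongrightarrow> (\<Sum>k. w k)"
  proof (rule tannerys_theorem[of "\<lambda>k n. w k * g (n + k)" w sequentially "\<lambda>k. norm (w k) * K",
        THEN conjunct2, THEN conjunct2])
    show "(\<lambda>n. w k * g (n + k)) \<longlonglongrightarrow> w k" for k
      using tendsto_mult[OF tendsto_const[of "w k"] LIMSEQ_ignore_initial_segment[OF g_tendsto, of k]] by simp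
    show "\<forall>\<^sub>F (k, n) in at_top \<times>\<^sub>F sequentially. norm (w k * g (n + k)) \<le> norm (w k) * K"
      using K by (intro always_eventually) (auto simp: norm_mult intro!: mult_left_mono)
  qed (use summable_mult2[OF summable_w] in auto)
  moreover have "(\<lambda>n. P2 (T n)) \<longlonglongrightarrow> 1"
    unfolding T_def using b by (intro P2_tendsto) simp
  ultimately show ?thesis
    unfolding Z_def [abs_def] L_def using tendsto_mult by fastforce
qed

text \<open>This is the quadratic transformation at T = -b. The difference of the sides solves the
  common recurrence along \<open>T n\<close> and tends to 0, so
  \<open>two_step_recurrence_unique\<close> applies.\<close>

lemma Z_eq_Y: "Z 0 = suminf w * Y 0"
proof -
  have "Z 0 - suminf w * Y 0 = 0"
  proof (rule two_step_recurrence_unique[where d = "\<lambda>n. Z n - suminf w * Y n"])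
    let ?a = "\<lambda>n. - (b * (1 + Q) * T n ^ 2)"
    let ?b = "\<lambda>n. (1 - Q ^ 2 * T n ^ 2 * x) * (1 - Q ^ 2 * T n ^ 2 / x)"
    \<comment> \<open>With s the norm of \<open>T n ^ 2\<close>, the coefficients are at most 2 s
      and (1 + s)^2 \<le> 1 + 3 s.\<close>
    let ?e = "\<lambda>n. 5 * norm (T n ^ 2)"
    show "Z n - suminf w * Y n = ?a n * (Z (Suc n) - suminf w * Y (Suc n))
        + ?b n * (Z (Suc (Suc n)) - suminf w * Y (Suc (Suc n)))" for n
    proof -
      have "A * z1 + B * z2 - s * (A * y1 + B * y2) = A * (z1 - s * y1) + B * (z2 - s * y2)"
        for A B s z1 z2 y1 y2 :: complex
        by (simp add: algebra_simps)
      then show ?thesis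
        by (subst Z_recurrence, subst Y_recurrence)
    qed
    show "norm (?a n) + norm (?b n) \<le> 1 + ?e n" for n
    proof -
      define s where "s = norm (T n ^ 2)"
      have s: "0 \<le> s" "s \<le> 1"
        using norm_T[of n] by (auto simp: s_def norm_power power_le_one)
      have Q2: "norm (Q ^ 2) \<le> 1"
        using norm_Q by (simp add: norm_power power_le_one)
      have "norm (b * (1 + Q)) \<le> 1 * (1 + 1)"
        unfolding norm_mult using b norm_Q
        by (intro mult_mono order_trans[OF norm_triangle_ineq] add_mono) auto
      then have "norm (?a n) \<le> 2 * s"
        unfolding norm_minus_cancel norm_mult[of "b * (1 + Q)"] s_def by (intro mult_right_mono) auto
      moreover have "norm (?b n) \<le> (1 + s) * (1 + s)"
        unfolding norm_mult
        by (intro mult_mono order_trans[OF norm_triangle_ineq4] add_mono)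
           (use Q2 s in \<open>auto simp: norm_mult norm_divide norm_x s_def mult_left_le_one_le\<close>)
      moreover have "(1 + s) * (1 + s) \<le> 1 + 3 * s"
        using mult_left_le[OF s(2,1)] by (simp add: algebra_simps)
      ultimately show ?thesis
        by (simp add: s_def)
    qed
    show "summable ?e"
    proof -
      have "?e n = 5 * norm b ^ 2 * (norm Q ^ 2) ^ n" for n
        by (simp add: T_def norm_mult norm_power power_mult_distrib power_mult [symmetric] mult.commute)
      then show ?thesis
        using norm_Q by (simp add: summable_mult summable_geometric power_less_one_iff)
    qed
    show "(\<lambda>n. Z n - suminf w * Y n) \<longlonglongrightarrow> 0"
      using tendsto_diff[OF Z_tendsto tendsto_mult[OF tendsto_const Y_tendsto], of "suminf w"] by simp
  qed auto
  then show ?thesis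
    by simp
qed

end

section \<open>Specialization to cube roots of unity\<close>

text \<open>By \<open>qpoch_inf_cube\<close>, \<open>P2 t\<close> is a quotient of a product in base
  Q^3 by one in base \<open>Q\<close>. In \<open>w k * g k\<close> the base \<open>Q\<close> tails
  complete the finite products of \<open>w k\<close> to constants, which leaves a q-binomial series
  in base Q^3.\<close>

lemma (in quadratic_transformation) Z_cube_root:
  assumes X_root: "1 + X + X ^ 2 = 0"
  shows "Z 0 = qpoch_inf (Q ^ 3) (Q ^ 3) * qpoch_inf (b ^ 4) (Q ^ 3)
    / (qpoch_inf Q Q * qpoch_inf (- b) (Q ^ 3))"
proof -
  have Q3: "norm (Q ^ 3) < 1"
    using norm_Q by (simp add: norm_power power_less_one_iff)
  have P2: "P2 t = qpoch_inf (t ^ 3) (Q ^ 3) / qpoch_inf t Q" if "norm t < 1" for t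
    using qpoch_inf_cube[OF norm_Q X_root, of t] qpoch_inf_nonzero[OF norm_Q that]
    by (simp add: P2_def field_simps)
  \<comment> \<open>The constant is \<open>g 0\<close>, as \<open>k = 0\<close> shows.\<close>
  define K where "K = qpoch_inf (- b) Q / qpoch_inf Q Q
    * (qpoch_inf (Q ^ 3) (Q ^ 3) / qpoch_inf (- (b ^ 3)) (Q ^ 3))"
  have b3: "norm (- (b ^ 3)) < 1"
    using norm_pow_b by simp
  have w_g: "w k * g k = K * (qpoch (- (b ^ 3)) (Q ^ 3) k / qpoch (Q ^ 3) (Q ^ 3) k * (- b) ^ k)" for k
  proof -
    have nQ: "norm (Q ^ Suc k) < 1"
      using norm_mult_power_less_1[OF norm_Q norm_Q, of k] by simp
    have nz: "qpoch (- (b ^ 3)) (Q ^ 3) k \<noteq> 0" "qpoch (Q ^ 3) (Q ^ 3) k \<noteq> 0"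
      "qpoch_inf (T k) Q \<noteq> 0" "qpoch_inf (Q ^ Suc k) Q \<noteq> 0"
      by (intro qpoch_nonzero qpoch_inf_nonzero norm_Q Q3 b3 norm_T nQ)+
    have "(- (b ^ 3)) * (Q ^ 3) ^ k = T k ^ 3" "Q ^ 3 * (Q ^ 3) ^ k = (Q ^ Suc k) ^ 3"
      by (simp_all add: T_def power_mult_distrib mult.commute flip: power_mult)
    then have splits: "qpoch_inf (- b) Q = qpoch (- b) Q k * qpoch_inf (T k) Q"
      "qpoch_inf Q Q = qpoch Q Q k * qpoch_inf (Q ^ Suc k) Q"
      "qpoch_inf (- (b ^ 3)) (Q ^ 3) = qpoch (- (b ^ 3)) (Q ^ 3) k * qpoch_inf (T k ^ 3) (Q ^ 3)"
      "qpoch_inf (Q ^ 3) (Q ^ 3) = qpoch (Q ^ 3) (Q ^ 3) k * qpoch_inf ((Q ^ Suc k) ^ 3) (Q ^ 3)"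
      using qpoch_inf_split[OF norm_Q, of "- b" k] qpoch_inf_split[OF norm_Q, of Q k]
        qpoch_inf_split[OF Q3, of "- (b ^ 3)" k] qpoch_inf_split[OF Q3, of "Q ^ 3" k]
      by (simp_all add: T_def)
    have "A / B * s * (C / b' / (D / a')) = A * a' / (B * b') * (B' * C / (A' * D)) * (A' / B' * s)"
      if "A' \<noteq> 0" "B' \<noteq> 0" "a' \<noteq> 0" "b' \<noteq> 0" for A B A' B' C D a' b' s :: complex
      using that by (simp add: field_simps)
    from this[OF nz] show ?thesis
      unfolding w_def g_def P2[OF norm_T] P2[OF nQ] K_def splits .
  qed
  have "(\<lambda>k. K * (qpoch (- (b ^ 3)) (Q ^ 3) k / qpoch (Q ^ 3) (Q ^ 3) k * (- b) ^ k)) sums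
      (K * (qpoch_inf (- (b ^ 3) * - b) (Q ^ 3) / qpoch_inf (- b) (Q ^ 3)))"
    using b by (intro sums_mult q_binomial Q3) simp
  then have "L 0 = K * (qpoch_inf (b ^ 4) (Q ^ 3) / qpoch_inf (- b) (Q ^ 3))"
    unfolding L_def using w_g by (simp add: sums_iff power3_eq_cube power4_eq_xxxx mult.assoc)
  moreover have "P2 (T 0) = qpoch_inf (- (b ^ 3)) (Q ^ 3) / qpoch_inf (- b) Q"
    using P2[of "- b"] b by (simp add: T_def)
  moreover have "qpoch_inf (- (b ^ 3)) (Q ^ 3) \<noteq> 0"
    by (rule qpoch_inf_nonzero[OF Q3 b3])
  moreover have "qpoch_inf (- b) Q \<noteq> 0"
    using b by (intro qpoch_inf_nonzero norm_Q) simp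
  ultimately show ?thesis
    by (simp add: Z_def K_def)
qed

section \<open>Product identity and conclusion\<close>

text \<open>Dissecting both sides produces the same factors. The relation b^2 = -Q gives (b Q)^2 =
  -Q^3 and (b Q^2)^2 = -Q^5, so products at opposite arguments pair up into base Q^6.\<close>

lemma qpoch_inf_identity:
  assumes Q: "norm Q < 1" and b: "b ^ 2 = - Q"
  shows "qpoch_inf (- b) Q * qpoch_inf (Q ^ 3) (Q ^ 3) * qpoch_inf (Q ^ 2) (Q ^ 3)
      * (qpoch_inf (b * Q) (Q ^ 3) * qpoch_inf (b * Q ^ 2) (Q ^ 3)) * qpoch_inf (Q ^ 4) (Q ^ 12)
    = qpoch_inf (b ^ 2) Q * qpoch_inf Q Q * qpoch_inf (- b) (Q ^ 3) * qpoch_inf (Q ^ 6) (Q ^ 12)"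
proof -
  have pow: "norm (Q ^ k) < 1" if "k > 0" for k
    using Q that by (simp add: norm_power power_less_one_iff)
  have lt: "{..<3} = {0, 1, 2::nat}" "{..<2} = {0, 1::nat}"
    by auto
  have "qpoch_inf (- b) Q = qpoch_inf (- b) (Q ^ 3)
      * (qpoch_inf (- (b * Q)) (Q ^ 3) * qpoch_inf (- (b * Q ^ 2)) (Q ^ 3))"
    using qpoch_inf_dissect[OF Q, of 3 "- b"] by (simp add: lt)
  moreover have "qpoch_inf (- (Q ^ 3)) (Q ^ 6) = qpoch_inf (b * Q) (Q ^ 3) * qpoch_inf (- (b * Q)) (Q ^ 3)"
    using qpoch_inf_square[OF pow[of 3], of "b * Q"]
    by (simp add: b power_mult_distrib flip: power_mult power_Suc)
  moreover have "qpoch_inf (- (Q ^ 5)) (Q ^ 6) = qpoch_inf (b * Q ^ 2) (Q ^ 3) * qpoch_inf (- (b * Q ^ 2)) (Q ^ 3)"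
    using qpoch_inf_square[OF pow[of 3], of "b * Q ^ 2"]
    by (simp add: b power_mult_distrib flip: power_mult power_Suc)
  moreover have "qpoch_inf (Q ^ 3) (Q ^ 3) = qpoch_inf (Q ^ 3) (Q ^ 6) * qpoch_inf (Q ^ 6) (Q ^ 6)"
    using qpoch_inf_dissect[OF pow[of 3], of 2 "Q ^ 3"] by (simp add: lt flip: power_mult power_add)
  moreover have "qpoch_inf (Q ^ 2) (Q ^ 3) = qpoch_inf (Q ^ 2) (Q ^ 6) * qpoch_inf (Q ^ 5) (Q ^ 6)"
  proof -
    have "Q ^ 2 * Q ^ 3 = Q ^ 5"
      by (simp flip: power_add)
    then show ?thesis
      using qpoch_inf_dissect[OF pow[of 3], of 2 "Q ^ 2"] by (simp add: lt flip: power_mult)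
  qed
  \<comment> \<open>As b^2 = -Q, the two products merge into one in base Q^2, which is split modulo
    3.\<close>
  moreover have "qpoch_inf (b ^ 2) Q * qpoch_inf Q Q
      = qpoch_inf (Q ^ 2) (Q ^ 6) * (qpoch_inf (Q ^ 4) (Q ^ 6) * qpoch_inf (Q ^ 6) (Q ^ 6))"
  proof -
    have "Q ^ 2 * Q ^ 2 = Q ^ 4" "Q ^ 2 * Q ^ 4 = Q ^ 6"
      by (simp_all flip: power_add)
    then show ?thesis
      using qpoch_inf_square[OF Q, of Q] qpoch_inf_dissect[OF pow[of 2], of 3 "Q ^ 2"]
      by (simp add: b lt mult.commute flip: power_mult)
  qed
  moreover have "qpoch_inf (Q ^ 6) (Q ^ 12) = qpoch_inf (Q ^ 3) (Q ^ 6) * qpoch_inf (- (Q ^ 3)) (Q ^ 6)"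
    using qpoch_inf_square[OF pow[of 6], of "Q ^ 3"] by (simp flip: power_mult)
  \<comment> \<open>Splitting modulo 2 gives arguments Q^4 and Q^10 in base Q^12; the second is the
    square of Q^5.\<close>
  moreover have "qpoch_inf (Q ^ 4) (Q ^ 6)
      = qpoch_inf (Q ^ 4) (Q ^ 12) * (qpoch_inf (Q ^ 5) (Q ^ 6) * qpoch_inf (- (Q ^ 5)) (Q ^ 6))"
    using qpoch_inf_dissect[OF pow[of 6], of 2 "Q ^ 4"] qpoch_inf_square[OF pow[of 6], of "Q ^ 5"]
    by (simp add: lt flip: power_mult power_add)
  ultimately show ?thesis
    by (simp add: mult_ac)
qed

theorem theorem6p2:
  fixes q r \<omega> :: complex
  assumes "0 < norm q" and "norm q < 1"
    and "primitive_root_of_unity 3 \<omega>"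
    and "r ^ 4 = q"
  shows "phi21 (r * \<omega>) (- (r ^ 3) * \<omega>) (- q) q (r ^ 2 * \<omega> ^ 2) =
    qpochs_inf [q ^ 3] (q ^ 6) /
    (qpochs_inf [r ^ 2 * \<omega> ^ 2] q
      * qpochs_inf [- (r ^ 3), r ^ 5] (- (r ^ 6))
      * qpochs_inf [q ^ 2] (q ^ 6))"
proof -
  have w3: "\<omega> ^ 3 = 1" and "\<omega> ^ 1 \<noteq> 1"
    using assms(3) unfolding primitive_root_of_unity_def by (auto dest: spec[of _ 1])
  moreover have "\<omega> ^ 3 - 1 = (\<omega> - 1) * (1 + \<omega> + \<omega> ^ 2)"
    by (simp add: power2_eq_square power3_eq_cube algebra_simps)
  ultimately have w_root: "1 + \<omega> + \<omega> ^ 2 = 0"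
    by simp
  have w4: "(\<omega> ^ 2) ^ 2 = \<omega>"
    using w3 by (simp add: power2_eq_square power3_eq_cube mult.assoc)
  have w_root': "1 + \<omega> ^ 2 + (\<omega> ^ 2) ^ 2 = 0"
    unfolding w4 using w_root by (simp add: algebra_simps)
  have w0: "\<omega> \<noteq> 0"
    using w3 by auto
  have norm_w: "norm \<omega> = 1"
    using power_eq_1_iff[OF w3] by simp
  have norm_r: "norm r < 1"
    using assms(2) by (simp add: norm_power power_less_one_iff flip: assms(4))
  \<comment> \<open>The choice X = \<omega>^2 makes x = X^2 = \<omega>, and \<open>X\<close> is
    again a primitive cube root of unity.\<close>
  interpret quadratic_transformation r "\<omega> ^ 2"
    using norm_r norm_w by unfold_locales (simp_all add: norm_power)
  have x: "x = \<omega>"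
    unfolding x_def w4 ..
  have "r ^ 2 / \<omega> = r ^ 2 * \<omega> ^ 2"
    using w3 w0 by (simp add: field_simps power2_eq_square power3_eq_cube)
  then have z: "z 0 = r ^ 2 * \<omega> ^ 2"
    by (simp add: z_def x)
  have q_Q: "q = Q ^ 2"
    using assms(4) b4 by simp
  have r_Q: "r ^ 2 = - Q" "- (r ^ 3) = r * Q" "r ^ 5 = r * Q ^ 2" "- (r ^ 6) = Q ^ 3"
    by (simp_all add: Q_def eval_nat_numeral)
  have "phi21 (r * \<omega>) (- (r ^ 3) * \<omega>) (- q) q (r ^ 2 * \<omega> ^ 2) = phi (z 0)"
    by (simp add: phi21_def phi_def qpochs_def c_def qpoch_def x z assms(4))
  \<comment> \<open>Both evaluations of \<open>Z 0\<close> are equated, with \<open>suminf w\<close>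
    written as a quotient of products.\<close>
  moreover have "qpoch_inf (r ^ 2 * \<omega> ^ 2) q * phi (z 0) * qpoch_inf (r ^ 2) Q / qpoch_inf (- r) Q
      = qpoch_inf (Q ^ 3) (Q ^ 3) * qpoch_inf (Q ^ 2) (Q ^ 3) / (qpoch_inf Q Q * qpoch_inf (- r) (Q ^ 3))"
    using Z_eq_Y Z_cube_root[OF w_root'] sum_w
    by (simp add: Y_def z w4 assms(4) b4 q_Q algebra_simps)
  moreover have "qpoch_inf (r ^ 2 * \<omega> ^ 2) q \<noteq> 0" "qpoch_inf (r ^ 2) Q \<noteq> 0" "qpoch_inf (- r) Q \<noteq> 0"
    "qpoch_inf Q Q \<noteq> 0" "qpoch_inf (- r) (Q ^ 3) \<noteq> 0" "qpoch_inf (- (r ^ 3)) (Q ^ 3) \<noteq> 0"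
    "qpoch_inf (r ^ 5) (Q ^ 3) \<noteq> 0" "qpoch_inf (q ^ 2) (q ^ 6) \<noteq> 0"
    using norm_r norm_w norm_Q assms(2)
    by (intro qpoch_inf_nonzero; simp add: norm_mult norm_power power_less_one_iff)+
  moreover have "qpoch_inf (- r) Q * qpoch_inf (Q ^ 3) (Q ^ 3) * qpoch_inf (Q ^ 2) (Q ^ 3)
      * (qpoch_inf (- (r ^ 3)) (Q ^ 3) * qpoch_inf (r ^ 5) (Q ^ 3)) * qpoch_inf (q ^ 2) (q ^ 6)
    = qpoch_inf (r ^ 2) Q * qpoch_inf Q Q * qpoch_inf (- r) (Q ^ 3) * qpoch_inf (q ^ 3) (q ^ 6)"
    using qpoch_inf_identity[OF norm_Q r_Q(1)] by (simp add: r_Q q_Q flip: power_mult)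
  \<comment> \<open>Solving for the series: \<open>l / m\<close> stands for \<open>suminf w\<close>,
    and the second premise is \<open>qpoch_inf_identity\<close>.\<close>
  moreover have "\<phi> = N / (A * B * C)"
    if "A * \<phi> * l / m = P1 * P2 / (R * S)" "m * P1 * P2 * B * C = l * R * S * N"
      "A \<noteq> 0" "l \<noteq> 0" "m \<noteq> 0" "R \<noteq> 0" "S \<noteq> 0" "B \<noteq> 0" "C \<noteq> 0"
    for \<phi> N A B C l m P1 P2 R S :: complex
  proof -
    have e: "A * \<phi> * (l * R * S) = m * P1 * P2"
      using that by (simp add: field_simps)
    have "\<phi> * (A * B * C) * (l * R * S) = A * \<phi> * (l * R * S) * (B * C)"
      by (simp only: mult_ac)
    also have "\<dots> = m * P1 * P2 * B * C"
      unfolding e by (simp only: mult.assoc)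
    also have "\<dots> = N * (l * R * S)"
      unfolding that(2) by (simp only: mult_ac)
    finally have "\<phi> * (A * B * C) * (l * R * S) = N * (l * R * S)" .
    then have "\<phi> * (A * B * C) = N"
      using that(3-) by simp
    then show ?thesis
      using that(3-) by (simp add: field_simps)
  qed
  ultimately show ?thesis
    by (simp add: qpochs_inf_def r_Q(4) flip: qpoch_inf_def)
qed

end
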